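(* Let $A$ be a finite-dimensional algebra over a field $k$ with a directed stratification given by idempotents $e_1,\dots,e_n$, and let $\mathcal{A}$ be the associated category. Suppose that $M$ is a finitely generated $A$-module and $\mathcal{P}$ a minimal projective resolution of $M$. Then for any $M$-minimal object $x$ in $\mathcal{A}$, $\mathcal{P}(x)$ is a minimal projective resolution of $M(x)$ as an $e_xAe_x$-module.
   Context: A finite-dimensional $k$-algebra $A$ has a directed stratification of length $n$, given by $e_1,\dots,e_n$, if $e_1,\dots,e_n\in A$ are pairwise orthogonal idempotents (not necessarily primitive) with $\sum_{i=1}^n e_i=1_A$ and $e_iAe_j=0$ for all $i<j$. Modules are left modules. The associated category $\mathcal{A}$ is the finite category whose objects $x_1,\dots,x_n$ are in bijective correspondence with $e_1,\dots,e_n$ and whose morphisms $x_i\to x_j$ are in bijective correspondence with a $k$-basis of $e_jAe_i$; in this way $A$ is regarded as the category algebra $k\mathcal{A}$. For an object $x=x_i$ write $e_x=e_i$, and write $\mathcal{A}(y,x)$ for the set of morphisms $y\to x$ in $\mathcal{A}$; thus $\mathcal{A}(y,x)\neq\emptyset$ means $e_xAe_y\neq 0$. Finitely generated $A$-modules are identified with representations of $\mathcal{A}$, that is, functors from $\mathcal{A}$ to finite-dimensional $k$-vector spaces; $M(x)=e_xM$ denotes the evaluation of $M$ at $x$, which is an $e_xAe_x$-module. For a complex $\mathcal{P}$ of $A$-modules, $\mathcal{P}(x)$ is the complex of $e_xAe_x$-modules obtained by evaluating every term and every differential at $x$. An object $x$ of $\mathcal{A}$ is $M$-minimal if $M(x)\neq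 0$ and $M(y)=0$ for every object $y\neq x$ with $\mathcal{A}(y,x)\neq\emptyset$.
   Formalization: The associated category is assumed to exist as a genuine finite category, so e_kAe_i ≠ 0 whenever e_kAe_j and e_jAe_i are nonzero; without this (e.g. k(1→2→3)/rad², M = S_1⊕S_3, x = 3, reading 𝒜(y,x)≠∅ as e_xAe_y≠0) the claim fails. *)

theory Defs
  imports "HOL-Algebra.Module" "HOL-Algebra.AbelCoset"
begin

section \<open>Finite-dimensional algebras\<close>

definition is_basis ::
    "('k, 'r) ring_scheme \<Rightarrow> ('k, 'v, 's) module_scheme \<Rightarrow> 'v set \<Rightarrow> 'v set \<Rightarrow> bool"
  where "is_basis K V W B \<longleftrightarrow> finite B \<and> B \<subseteq> W \<and>
    (\<forall>v\<in>W. \<exists>!c. c \<in> B \<rightarrow>\<^sub>E carrier K \<and> v = (\<Oplus>\<^bsub>V\<^esub>b\<in>B. c b \<odot>\<^bsub>V\<^esub> b))"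

text \<open>The locale \<open>algebra\<close> of the library is about commutative algebras only.\<close>

locale fin_dim_algebra = K?: field K + A?: ring A + module K A
  for K :: "('k, 'r) ring_scheme" (structure) and A :: "('k, 'a, 's) module_scheme" (structure) +
  assumes smult_mult_left: "\<lbrakk>c \<in> carrier K; a \<in> carrier A; b \<in> carrier A\<rbrakk> \<Longrightarrow>
      (c \<odot>\<^bsub>A\<^esub> a) \<otimes>\<^bsub>A\<^esub> b = c \<odot>\<^bsub>A\<^esub> (a \<otimes>\<^bsub>A\<^esub> b)"
    and smult_mult_right: "\<lbrakk>c \<in> carrier K; a \<in> carrier A; b \<in> carrier A\<rbrakk> \<Longrightarrow>
      a \<otimes>\<^bsub>A\<^esub> (c \<odot>\<^bsub>A\<^esub> b) = c \<odot>\<^bsub>A\<^esub> (a \<otimes>\<^bsub>A\<^esub> b)"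
    and fin_dim: "\<exists>B. is_basis K A (carrier A) B"

section \<open>Left modules over a possibly noncommutative ring\<close>

text \<open>The locale \<open>module\<close> of the library requires a commutative ring; its record and
  \<open>submodule\<close> do not. The fields \<open>mult\<close> and \<open>one\<close> of a module record carry no information.\<close>

locale left_module = R?: ring R + M?: abelian_group M
  for R :: "('a, 'r) ring_scheme" (structure) and M :: "('a, 'm, 's) module_scheme" (structure) +
  assumes smult_closed [simp, intro]:
      "\<lbrakk>a \<in> carrier R; x \<in> carrier M\<rbrakk> \<Longrightarrow> a \<odot>\<^bsub>M\<^esub> x \<in> carrier M"
    and smult_l_distr: "\<lbrakk>a \<in> carrier R; b \<in> carrier R; x \<in> carrier M\<rbrakk> \<Longrightarrow>
      (a \<oplus> b) \<odot>\<^bsub>M\<^esub> x = a \<odot>\<^bsub>M\<^esub> x \<oplus>\<^bsub>M\<^esub> b \<odot>\<^bsub>M\<^esub> x"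
    and smult_r_distr: "\<lbrakk>a \<in> carrier R; x \<in> carrier M; y \<in> carrier M\<rbrakk> \<Longrightarrow>
      a \<odot>\<^bsub>M\<^esub> (x \<oplus>\<^bsub>M\<^esub> y) = a \<odot>\<^bsub>M\<^esub> x \<oplus>\<^bsub>M\<^esub> a \<odot>\<^bsub>M\<^esub> y"
    and smult_assoc: "\<lbrakk>a \<in> carrier R; b \<in> carrier R; x \<in> carrier M\<rbrakk> \<Longrightarrow>
      (a \<otimes> b) \<odot>\<^bsub>M\<^esub> x = a \<odot>\<^bsub>M\<^esub> (b \<odot>\<^bsub>M\<^esub> x)"
    and smult_one [simp]: "x \<in> carrier M \<Longrightarrow> \<one> \<odot>\<^bsub>M\<^esub> x = x"

definition finitely_generated ::
    "('a, 'r) ring_scheme \<Rightarrow> ('a, 'm, 's) module_scheme \<Rightarrow> bool"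
  where "finitely_generated R M \<longleftrightarrow> (\<exists>G. finite G \<and> G \<subseteq> carrier M \<and>
    (\<forall>x\<in>carrier M. \<exists>c\<in>G \<rightarrow> carrier R. x = (\<Oplus>\<^bsub>M\<^esub>g\<in>G. c g \<odot>\<^bsub>M\<^esub> g)))"

definition lin_hom :: "('a, 'r) ring_scheme \<Rightarrow> ('a, 'm, 's) module_scheme \<Rightarrow>
    ('a, 'n, 't) module_scheme \<Rightarrow> ('m \<Rightarrow> 'n) set"
  where "lin_hom R M N = {f \<in> carrier M \<rightarrow> carrier N.
    (\<forall>x\<in>carrier M. \<forall>y\<in>carrier M. f (x \<oplus>\<^bsub>M\<^esub> y) = f x \<oplus>\<^bsub>N\<^esub> f y) \<and>
    (\<forall>a\<in>carrier R. \<forall>x\<in>carrier M. f (a \<odot>\<^bsub>M\<^esub> x) = a \<odot>\<^bsub>N\<^esub> f x)}"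

definition superfluous ::
    "('a, 'r) ring_scheme \<Rightarrow> ('a, 'm, 's) module_scheme \<Rightarrow> 'm set \<Rightarrow> bool"
  where "superfluous R M N \<longleftrightarrow> submodule N R M \<and>
    (\<forall>L. submodule L R M \<and> L <+>\<^bsub>M\<^esub> N = carrier M \<longrightarrow> L = carrier M)"

section \<open>Projective modules\<close>

text \<open>The direct sum of copies of \<open>R\<close> indexed by \<open>I\<close>: finitely supported functions.\<close>

definition free_module :: "('a, 'r) ring_scheme \<Rightarrow> 'i set \<Rightarrow> ('a, 'i \<Rightarrow> 'a) module"
  where "free_module R I = \<lparr>
    carrier = {v. (\<forall>i. v i \<in> carrier R) \<and> (\<forall>i. i \<notin> I \<longrightarrow> v i = \<zero>\<^bsub>R\<^esub>) \<and> finite {i. v i \<noteq> \<zero>\<^bsub>R\<^esub>}},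
    mult = undefined, one = undefined,
    zero = (\<lambda>i. \<zero>\<^bsub>R\<^esub>), add = (\<lambda>v w i. v i \<oplus>\<^bsub>R\<^esub> w i),
    smult = (\<lambda>a v i. a \<otimes>\<^bsub>R\<^esub> v i)\<rparr>"

text \<open>Projective means: a direct summand (up to isomorphism) of a free module. Rank bounded by
  the type of the elements of \<open>P\<close> is enough: the lemmas \<open>projective_lift\<close> and
  \<open>projectiveI_lift\<close> below show that this is the lifting property against all modules, of
  arbitrary types.\<close>

definition projective :: "('a, 'r) ring_scheme \<Rightarrow> ('a, 'm, 's) module_scheme \<Rightarrow> bool"
  where "projective R P \<longleftrightarrow> left_module R P \<and>
    (\<exists>(I :: 'm set) s r. s \<in> lin_hom R P (free_module R I) \<and> r \<in> lin_hom R (free_module R I) P \<and>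
      (\<forall>p\<in>carrier P. r (s p) = p))"

section \<open>Minimal projective resolutions\<close>

definition projective_cover :: "('a, 'r) ring_scheme \<Rightarrow> ('a, 'm, 's) module_scheme \<Rightarrow>
    ('m \<Rightarrow> 'n) \<Rightarrow> ('a, 'n, 't) module_scheme \<Rightarrow> bool"
  where "projective_cover R P f N \<longleftrightarrow> projective R P \<and> left_module R N \<and>
    f \<in> lin_hom R P N \<and> f ` carrier P = carrier N \<and> superfluous R P (a_kernel P N f)"

text \<open>A resolution is \<open>\<dots> \<rightarrow> P 2 \<rightarrow> P 1 \<rightarrow> P 0 \<rightarrow> M \<rightarrow> 0\<close> with \<open>d i\<close> mapping
  \<open>P (i + 1)\<close> to \<open>P i\<close> and augmentation \<open>\<epsilon>\<close>.\<close>

definition projective_resolution :: "('a, 'r) ring_scheme \<Rightarrow> (nat \<Rightarrow> ('a, 'm, 's) module_scheme) \<Rightarrow>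
    (nat \<Rightarrow> 'm \<Rightarrow> 'm) \<Rightarrow> ('m \<Rightarrow> 'n) \<Rightarrow> ('a, 'n, 't) module_scheme \<Rightarrow> bool"
  where "projective_resolution R P d \<epsilon> M \<longleftrightarrow> left_module R M \<and> (\<forall>i. projective R (P i)) \<and>
    \<epsilon> \<in> lin_hom R (P 0) M \<and> (\<forall>i. d i \<in> lin_hom R (P (Suc i)) (P i)) \<and>
    \<epsilon> ` carrier (P 0) = carrier M \<and>
    d 0 ` carrier (P 1) = a_kernel (P 0) M \<epsilon> \<and>
    (\<forall>i. d (Suc i) ` carrier (P (Suc (Suc i))) = a_kernel (P (Suc i)) (P i) (d i))"

definition minimal_projective_resolution :: "('a, 'r) ring_scheme \<Rightarrow>
    (nat \<Rightarrow> ('a, 'm, 's) module_scheme) \<Rightarrow> (nat \<Rightarrow> 'm \<Rightarrow> 'm) \<Rightarrow> ('m \<Rightarrow> 'n) \<Rightarrow>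
    ('a, 'n, 't) module_scheme \<Rightarrow> bool"
  where "minimal_projective_resolution R P d \<epsilon> M \<longleftrightarrow> projective_resolution R P d \<epsilon> M \<and>
    projective_cover R (P 0) \<epsilon> M \<and>
    (\<forall>i. projective_cover R (P (Suc i)) (d i)
           ((P i)\<lparr>carrier := d i ` carrier (P (Suc i))\<rparr>))"

section \<open>Evaluation at an idempotent\<close>

definition corner_ring :: "('a, 'r) ring_scheme \<Rightarrow> 'a \<Rightarrow> ('a, 'r) ring_scheme"
  where "corner_ring A e = A\<lparr>carrier := {e \<otimes>\<^bsub>A\<^esub> a \<otimes>\<^bsub>A\<^esub> e | a. a \<in> carrier A}, one := e\<rparr>"

text \<open>A homomorphism \<open>f\<close> is evaluated by restricting it to the carrier of the evaluated
  module; since \<open>lin_hom\<close> only looks at values on the carrier, the same function \<open>f\<close>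
  represents the restriction.\<close>

definition eval_at :: "('a, 'm, 's) module_scheme \<Rightarrow> 'a \<Rightarrow> ('a, 'm, 's) module_scheme"
  where "eval_at M e = M\<lparr>carrier := (\<lambda>m. e \<odot>\<^bsub>M\<^esub> m) ` carrier M\<rparr>"

section \<open>Directed stratifications and the associated category\<close>

definition directed_stratification :: "('a, 'r) ring_scheme \<Rightarrow> nat \<Rightarrow> (nat \<Rightarrow> 'a) \<Rightarrow> bool"
  where "directed_stratification A n e \<longleftrightarrow>
    (\<forall>i\<in>{1..n}. e i \<in> carrier A \<and> e i \<otimes>\<^bsub>A\<^esub> e i = e i) \<and>
    (\<forall>i\<in>{1..n}. \<forall>j\<in>{1..n}. i \<noteq> j \<longrightarrow> e i \<otimes>\<^bsub>A\<^esub> e j = \<zero>\<^bsub>A\<^esub>) \<and>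
    (\<Oplus>\<^bsub>A\<^esub>i\<in>{1..n}. e i) = \<one>\<^bsub>A\<^esub> \<and>
    (\<forall>i\<in>{1..n}. \<forall>j\<in>{1..n}. i < j \<longrightarrow>
      {e i \<otimes>\<^bsub>A\<^esub> a \<otimes>\<^bsub>A\<^esub> e j | a. a \<in> carrier A} = {\<zero>\<^bsub>A\<^esub>})"

record ('o, 'f) category =
  Obj :: "'o set"
  Mor :: "'f set"
  Dom :: "'f \<Rightarrow> 'o"
  Cod :: "'f \<Rightarrow> 'o"
  Ident :: "'o \<Rightarrow> 'f"
  Comp :: "'f \<Rightarrow> 'f \<Rightarrow> 'f"

definition hom_set :: "('o, 'f, 'z) category_scheme \<Rightarrow> 'o \<Rightarrow> 'o \<Rightarrow> 'f set"
  where "hom_set C x y = {f \<in> Mor C. Dom C f = x \<and> Cod C f = y}"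

text \<open>\<open>Comp C g f\<close> is \<open>g\<close> after \<open>f\<close>.\<close>

locale finite_category =
  fixes C :: "('o, 'f, 'z) category_scheme"
  assumes finite_Obj: "finite (Obj C)"
    and finite_Mor: "finite (Mor C)"
    and dom_Obj: "f \<in> Mor C \<Longrightarrow> Dom C f \<in> Obj C"
    and cod_Obj: "f \<in> Mor C \<Longrightarrow> Cod C f \<in> Obj C"
    and ident_hom: "x \<in> Obj C \<Longrightarrow> Ident C x \<in> hom_set C x x"
    and compose_hom: "\<lbrakk>f \<in> hom_set C x y; g \<in> hom_set C y z\<rbrakk> \<Longrightarrow> Comp C g f \<in> hom_set C x z"
    and compose_ident_left: "f \<in> hom_set C x y \<Longrightarrow> Comp C (Ident C y) f = f"
    and compose_ident_right: "f \<in> hom_set C x y \<Longrightarrow> Comp C f (Ident C x) = f"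
    and compose_assoc:
      "\<lbrakk>f \<in> hom_set C w x; g \<in> hom_set C x y; h \<in> hom_set C y z\<rbrakk> \<Longrightarrow>
        Comp C h (Comp C g f) = Comp C (Comp C h g) f"

text \<open>The object \<open>x\<^sub>i\<close> is the index \<open>i\<close>, and the morphisms from \<open>x\<^sub>i\<close> to \<open>x\<^sub>j\<close> correspond to a
  basis of \<open>e\<^sub>j A e\<^sub>i\<close>. No relation between the composition of \<open>C\<close> and the product of \<open>A\<close> is
  demanded: the product of two basis elements is in general not a basis element (it may be zero).
  In particular, every case in which \<open>A\<close> is literally the category algebra of \<open>C\<close> is covered.
  That \<open>C\<close> is a category is not automatic: it forces \<open>e\<^sub>k A e\<^sub>i\<close> to be nonzero
  whenever \<open>e\<^sub>k A e\<^sub>j\<close> and \<open>e\<^sub>j A e\<^sub>i\<close> are.\<close>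

definition associated_category :: "('k, 'r) ring_scheme \<Rightarrow> ('k, 'a, 's) module_scheme \<Rightarrow> nat \<Rightarrow>
    (nat \<Rightarrow> 'a) \<Rightarrow> (nat, 'f, 'z) category_scheme \<Rightarrow> bool"
  where "associated_category K A n e C \<longleftrightarrow> finite_category C \<and> Obj C = {1..n} \<and>
    (\<forall>i\<in>{1..n}. \<forall>j\<in>{1..n}. \<exists>B \<beta>.
      is_basis K A {e j \<otimes>\<^bsub>A\<^esub> a \<otimes>\<^bsub>A\<^esub> e i | a. a \<in> carrier A} B \<and> bij_betw \<beta> (hom_set C i j) B)"

definition minimal_object :: "(nat, 'f, 'z) category_scheme \<Rightarrow> (nat \<Rightarrow> 'a) \<Rightarrow>
    ('a, 'm, 's) module_scheme \<Rightarrow> nat \<Rightarrow> bool"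
  where "minimal_object C e M x \<longleftrightarrow> x \<in> Obj C \<and> carrier (eval_at M (e x)) \<noteq> {\<zero>\<^bsub>M\<^esub>} \<and>
    (\<forall>y\<in>Obj C. y \<noteq> x \<and> hom_set C y x \<noteq> {} \<longrightarrow> carrier (eval_at M (e y)) = {\<zero>\<^bsub>M\<^esub>})"

section \<open>Projectivity as a lifting property\<close>

context left_module
begin

lemma smult_l_null [simp]: assumes "x \<in> carrier M" shows "\<zero> \<odot>\<^bsub>M\<^esub> x = \<zero>\<^bsub>M\<^esub>"
proof -
  have "\<zero> \<odot>\<^bsub>M\<^esub> x = \<zero> \<odot>\<^bsub>M\<^esub> x \<oplus>\<^bsub>M\<^esub> \<zero> \<odot>\<^bsub>M\<^esub> x"
    using smult_l_distr[of \<zero> \<zero> x] assms by simp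
  then show ?thesis using assms by (metis M.add.r_cancel_one' R.zero_closed smult_closed)
qed

lemma smult_r_null [simp]: assumes "a \<in> carrier R" shows "a \<odot>\<^bsub>M\<^esub> \<zero>\<^bsub>M\<^esub> = \<zero>\<^bsub>M\<^esub>"
proof -
  have "a \<odot>\<^bsub>M\<^esub> \<zero>\<^bsub>M\<^esub> = a \<odot>\<^bsub>M\<^esub> \<zero>\<^bsub>M\<^esub> \<oplus>\<^bsub>M\<^esub> a \<odot>\<^bsub>M\<^esub> \<zero>\<^bsub>M\<^esub>"
    using smult_r_distr[of a "\<zero>\<^bsub>M\<^esub>" "\<zero>\<^bsub>M\<^esub>"] assms by simp
  then show ?thesis using assms by (metis M.add.r_cancel_one' M.zero_closed smult_closed)
qed

lemma finsum_smult:
  assumes "finite S" "a \<in> carrier R" "f \<in> S \<rightarrow> carrier M"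
  shows "(\<Oplus>\<^bsub>M\<^esub>i\<in>S. a \<odot>\<^bsub>M\<^esub> f i) = a \<odot>\<^bsub>M\<^esub> (\<Oplus>\<^bsub>M\<^esub>i\<in>S. f i)"
  using assms
proof (induction S rule: finite_induct)
  case empty then show ?case by simp
next
  case (insert i S)
  then have "f i \<in> carrier M" "f \<in> S \<rightarrow> carrier M" by auto
  with insert show ?case by (simp add: Pi_def smult_r_distr)
qed

definition lin_ext :: "('i \<Rightarrow> 'm) \<Rightarrow> ('i \<Rightarrow> 'a) \<Rightarrow> 'm"
  where "lin_ext n v = (\<Oplus>\<^bsub>M\<^esub>i\<in>{i. v i \<noteq> \<zero>}. v i \<odot>\<^bsub>M\<^esub> n i)"

lemma lin_ext_superset:
  assumes "finite S" "S \<subseteq> I" "{i. v i \<noteq> \<zero>} \<subseteq> S"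
    and "\<And>i. v i \<in> carrier R" "\<And>i. i \<in> I \<Longrightarrow> n i \<in> carrier M"
  shows "lin_ext n v = (\<Oplus>\<^bsub>M\<^esub>i\<in>S. v i \<odot>\<^bsub>M\<^esub> n i)"
  unfolding lin_ext_def
  by (rule M.add.finprod_mono_neutral_cong_left) (use assms in \<open>auto simp: subset_iff\<close>)

lemma lin_ext_hom:
  assumes n: "\<And>i. i \<in> I \<Longrightarrow> n i \<in> carrier M"
  shows "lin_ext n \<in> lin_hom R (free_module R I) M"
proof -
  let ?supp = "\<lambda>v. {i. v i \<noteq> \<zero>}"
  have supp: "?supp v \<subseteq> I" "finite (?supp v)" "v i \<in> carrier R"
    if "v \<in> carrier (free_module R I)" for v i
    using that by (auto simp: free_module_def)
  have closed: "lin_ext n v \<in> carrier M" if v: "v \<in> carrier (free_module R I)" for v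
    unfolding lin_ext_def
    by (rule M.finsum_closed) (use supp[OF v] n in auto)
  have add: "lin_ext n (v \<oplus>\<^bsub>free_module R I\<^esub> w) = lin_ext n v \<oplus>\<^bsub>M\<^esub> lin_ext n w"
    if v: "v \<in> carrier (free_module R I)" and w: "w \<in> carrier (free_module R I)" for v w
  proof -
    let ?S = "?supp v \<union> ?supp w"
    have S: "finite ?S" "?S \<subseteq> I" using supp[OF v] supp[OF w] by auto
    have "lin_ext n (\<lambda>i. v i \<oplus> w i) = (\<Oplus>\<^bsub>M\<^esub>i\<in>?S. (v i \<oplus> w i) \<odot>\<^bsub>M\<^esub> n i)"
      by (rule lin_ext_superset[OF S]) (use supp(3)[OF v] supp(3)[OF w] n in auto)
    also have "\<dots> = (\<Oplus>\<^bsub>M\<^esub>i\<in>?S. v i \<odot>\<^bsub>M\<^esub> n i \<oplus>\<^bsub>M\<^esub> w i \<odot>\<^bsub>M\<^esub> n i)"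
      by (rule M.finsum_cong')
        (use supp(3)[OF v] supp(3)[OF w] n S in \<open>auto simp: smult_l_distr subset_iff\<close>)
    also have "\<dots> = (\<Oplus>\<^bsub>M\<^esub>i\<in>?S. v i \<odot>\<^bsub>M\<^esub> n i) \<oplus>\<^bsub>M\<^esub> (\<Oplus>\<^bsub>M\<^esub>i\<in>?S. w i \<odot>\<^bsub>M\<^esub> n i)"
      by (rule M.finsum_addf) (use supp(3)[OF v] supp(3)[OF w] n S in \<open>auto simp: subset_iff\<close>)
    also have "(\<Oplus>\<^bsub>M\<^esub>i\<in>?S. v i \<odot>\<^bsub>M\<^esub> n i) = lin_ext n v"
      by (rule lin_ext_superset[OF S, symmetric]) (use supp(3)[OF v] n in auto)
    also have "(\<Oplus>\<^bsub>M\<^esub>i\<in>?S. w i \<odot>\<^bsub>M\<^esub> n i) = lin_ext n w"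
      by (rule lin_ext_superset[OF S, symmetric]) (use supp(3)[OF w] n in auto)
    finally show ?thesis by (simp add: free_module_def)
  qed
  have scale: "lin_ext n (a \<odot>\<^bsub>free_module R I\<^esub> v) = a \<odot>\<^bsub>M\<^esub> lin_ext n v"
    if a: "a \<in> carrier R" and v: "v \<in> carrier (free_module R I)" for a v
  proof -
    have "lin_ext n (\<lambda>i. a \<otimes> v i) = (\<Oplus>\<^bsub>M\<^esub>i\<in>?supp v. (a \<otimes> v i) \<odot>\<^bsub>M\<^esub> n i)"
      by (rule lin_ext_superset[OF supp(2,1)[OF v]]) (use supp(3)[OF v] a n in auto)
    also have "\<dots> = (\<Oplus>\<^bsub>M\<^esub>i\<in>?supp v. a \<odot>\<^bsub>M\<^esub> (v i \<odot>\<^bsub>M\<^esub> n i))"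
      by (rule M.finsum_cong') (use supp[OF v] a n in \<open>auto simp: smult_assoc subset_iff\<close>)
    also have "\<dots> = a \<odot>\<^bsub>M\<^esub> lin_ext n v"
      unfolding lin_ext_def
      by (rule finsum_smult) (use supp[OF v] a n in \<open>auto simp: subset_iff\<close>)
    finally show ?thesis by (simp add: free_module_def)
  qed
  show ?thesis using closed add scale by (auto simp: lin_hom_def)
qed

end

definition unit_vec :: "('a, 'r) ring_scheme \<Rightarrow> 'i \<Rightarrow> 'i \<Rightarrow> 'a"
  where "unit_vec R i = (\<lambda>j. if j = i then \<one>\<^bsub>R\<^esub> else \<zero>\<^bsub>R\<^esub>)"

lemma (in ring) unit_vec_closed: "i \<in> I \<Longrightarrow> unit_vec R i \<in> carrier (free_module R I)"
  by (auto simp: unit_vec_def free_module_def intro: finite_subset[of _ "{i}"])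

lemma (in left_module) lin_ext_unit_vec:
  assumes "n i \<in> carrier M" shows "lin_ext n (unit_vec R i) = n i"
proof -
  have "lin_ext n (unit_vec R i) = (\<Oplus>\<^bsub>M\<^esub>j\<in>{i}. unit_vec R i j \<odot>\<^bsub>M\<^esub> n j)"
    by (rule lin_ext_superset[where I = "{i}"]) (use assms in \<open>auto simp: unit_vec_def\<close>)
  also have "\<dots> = n i" using assms by (simp add: unit_vec_def)
  finally show ?thesis .
qed

lemma left_module_free_module:
  fixes R :: "('a, 'r) ring_scheme" and I :: "'i set"
  assumes "ring R" shows "left_module R (free_module R I)"
proof -
  interpret ring R by fact
  have sub: "finite {i. u i \<noteq> \<zero>\<^bsub>R\<^esub>}" if "finite {i. v i \<noteq> \<zero>\<^bsub>R\<^esub>}" "finite {i. w i \<noteq> \<zero>\<^bsub>R\<^esub>}"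
    "\<And>i. v i = \<zero>\<^bsub>R\<^esub> \<Longrightarrow> w i = \<zero>\<^bsub>R\<^esub> \<Longrightarrow> u i = \<zero>\<^bsub>R\<^esub>" for u v w :: "'i \<Rightarrow> 'a"
    by (rule finite_subset[OF _ finite_UnI[OF that(1,2)]]) (use that(3) in auto)
  have ag: "abelian_group (free_module R I)"
  proof (rule abelian_groupI)
    fix v w assume "v \<in> carrier (free_module R I)" "w \<in> carrier (free_module R I)"
    then show "v \<oplus>\<^bsub>free_module R I\<^esub> w \<in> carrier (free_module R I)"
      by (auto simp: free_module_def intro!: sub[of v w])
  next
    fix v assume v: "v \<in> carrier (free_module R I)"
    show "\<exists>w\<in>carrier (free_module R I). w \<oplus>\<^bsub>free_module R I\<^esub> v = \<zero>\<^bsub>free_module R I\<^esub>"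
      by (rule bexI[of _ "\<lambda>i. \<ominus>\<^bsub>R\<^esub> v i"])
        (use v in \<open>auto simp: free_module_def l_neg intro!: sub[of v v]\<close>)
  qed (auto simp: free_module_def a_ac)
  show ?thesis
  proof (intro left_module.intro left_module_axioms.intro ag)
    fix a v assume "a \<in> carrier R" "v \<in> carrier (free_module R I)"
    then show "a \<odot>\<^bsub>free_module R I\<^esub> v \<in> carrier (free_module R I)"
      by (auto simp: free_module_def intro!: sub[of v v])
  qed (auto simp: free_module_def l_distr r_distr m_assoc assms)
qed

lemma lin_hom_comp:
  "\<lbrakk>f \<in> lin_hom R L M; g \<in> lin_hom R M N\<rbrakk> \<Longrightarrow> (\<lambda>x. g (f x)) \<in> lin_hom R L N"
  by (auto simp: lin_hom_def Pi_def)

lemma free_module_hom_eq: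
  assumes "left_module R N"
    and f: "f \<in> lin_hom R (free_module R I) N" and g: "g \<in> lin_hom R (free_module R I) N"
    and eq: "\<And>i. i \<in> I \<Longrightarrow> f (unit_vec R i) = g (unit_vec R i)"
    and v: "v \<in> carrier (free_module R I)"
  shows "f v = g v"
proof -
  interpret left_module R N by fact
  let ?F = "free_module R I"
  interpret F: left_module R ?F by (rule left_module_free_module) unfold_locales
  have zero: "h \<zero>\<^bsub>?F\<^esub> = \<zero>\<^bsub>N\<^esub>" if h: "h \<in> lin_hom R ?F N" for h
  proof -
    have "h (\<zero>\<^bsub>R\<^esub> \<odot>\<^bsub>?F\<^esub> \<zero>\<^bsub>?F\<^esub>) = \<zero>\<^bsub>R\<^esub> \<odot>\<^bsub>N\<^esub> h \<zero>\<^bsub>?F\<^esub>" "h \<zero>\<^bsub>?F\<^esub> \<in> carrier N"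
      using h F.M.zero_closed R.zero_closed unfolding lin_hom_def by blast+
    then show ?thesis by simp
  qed
  have "finite {i. v i \<noteq> \<zero>\<^bsub>R\<^esub>}" using v by (simp add: free_module_def)
  then show ?thesis using v
  proof (induction "{i. v i \<noteq> \<zero>\<^bsub>R\<^esub>}" arbitrary: v rule: finite_induct)
    case empty
    then have "v = \<zero>\<^bsub>?F\<^esub>" by (auto simp: free_module_def)
    then show ?case using zero[OF f] zero[OF g] by simp
  next
    case (insert i S v)
    let ?w = "v(i := \<zero>\<^bsub>R\<^esub>)"
    have vi: "v i \<noteq> \<zero>\<^bsub>R\<^esub>" "i \<in> I" "v i \<in> carrier R"
      using insert by (auto simp: free_module_def)
    have S: "S = {j. ?w j \<noteq> \<zero>\<^bsub>R\<^esub>}" using insert(2,4) by auto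
    have w: "?w \<in> carrier ?F" using insert.prems insert.hyps(1) S by (auto simp: free_module_def)
    have u: "unit_vec R i \<in> carrier ?F" using vi by (simp add: R.unit_vec_closed)
    have "v = ?w \<oplus>\<^bsub>?F\<^esub> v i \<odot>\<^bsub>?F\<^esub> unit_vec R i"
      using insert.prems by (auto simp: free_module_def unit_vec_def)
    then obtain w where w': "w = ?w" "v = w \<oplus>\<^bsub>?F\<^esub> v i \<odot>\<^bsub>?F\<^esub> unit_vec R i" by blast
    have "h v = h w \<oplus>\<^bsub>N\<^esub> v i \<odot>\<^bsub>N\<^esub> h (unit_vec R i)" if h: "h \<in> lin_hom R ?F N" for h
    proof -
      have "h v = h (w \<oplus>\<^bsub>?F\<^esub> v i \<odot>\<^bsub>?F\<^esub> unit_vec R i)" using w'(2) by simp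
      also have "\<dots> = h w \<oplus>\<^bsub>N\<^esub> h (v i \<odot>\<^bsub>?F\<^esub> unit_vec R i)"
        using h w w'(1) F.smult_closed[OF vi(3) u] by (simp add: lin_hom_def)
      also have "\<dots> = h w \<oplus>\<^bsub>N\<^esub> v i \<odot>\<^bsub>N\<^esub> h (unit_vec R i)"
        using h u vi by (simp add: lin_hom_def)
      finally show ?thesis .
    qed
    from this[OF f] this[OF g] show ?case using eq[OF vi(2)] insert.hyps(3)[OF S w] w'(1) by simp
  qed
qed

lemma projective_lift:
  fixes R :: "('a, 'r) ring_scheme" and P :: "('a, 'm, 's) module_scheme"
    and N :: "('a, 'n, 't) module_scheme" and N' :: "('a, 'l, 'u) module_scheme"
  assumes "projective R P" and "left_module R N" and "left_module R N'"
    and g: "g \<in> lin_hom R N N'" "g ` carrier N = carrier N'"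
    and f: "f \<in> lin_hom R P N'"
  shows "\<exists>h\<in>lin_hom R P N. \<forall>p\<in>carrier P. g (h p) = f p"
proof -
  interpret N: left_module R N by fact
  from assms(1) obtain I :: "'m set" and s r where s: "s \<in> lin_hom R P (free_module R I)"
    and r: "r \<in> lin_hom R (free_module R I) P" and rs: "\<And>p. p \<in> carrier P \<Longrightarrow> r (s p) = p"
    unfolding projective_def by blast
  have fr: "(\<lambda>v. f (r v)) \<in> lin_hom R (free_module R I) N'" using lin_hom_comp[OF r f] .
  have "\<forall>i\<in>I. \<exists>x\<in>carrier N. g x = f (r (unit_vec R i))"
  proof
    fix i assume "i \<in> I"
    then have "f (r (unit_vec R i)) \<in> carrier N'"
      using fr N.R.unit_vec_closed[of i I] by (auto simp: lin_hom_def)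
    then show "\<exists>x\<in>carrier N. g x = f (r (unit_vec R i))" using g(2) by (metis imageE)
  qed
  then obtain n where n: "\<And>i. i \<in> I \<Longrightarrow> n i \<in> carrier N"
    "\<And>i. i \<in> I \<Longrightarrow> g (n i) = f (r (unit_vec R i))" by metis
  have e: "N.lin_ext n \<in> lin_hom R (free_module R I) N" using n(1) by (rule N.lin_ext_hom)
  have eq: "g (N.lin_ext n v) = f (r v)" if "v \<in> carrier (free_module R I)" for v
    by (rule free_module_hom_eq[OF assms(3) lin_hom_comp[OF e g(1)] fr _ that])
      (simp add: N.lin_ext_unit_vec n)
  show ?thesis
  proof (rule bexI[OF _ lin_hom_comp[OF s e]], rule ballI)
    fix p assume p: "p \<in> carrier P"
    then have "s p \<in> carrier (free_module R I)" using s by (auto simp: lin_hom_def)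
    then show "g (N.lin_ext n (s p)) = f p" by (simp add: eq rs p)
  qed
qed

text \<open>Conversely, lifting the identity along the surjections onto \<open>P\<close> from modules of one
  sufficiently large type is enough.\<close>

lemma projectiveI_lift:
  fixes R :: "('a, 'r) ring_scheme" and P :: "('a, 'm, 's) module_scheme"
  assumes "left_module R P"
    and lift: "\<And>(N :: ('a, 'm \<Rightarrow> 'a) module) g. \<lbrakk>left_module R N; g \<in> lin_hom R N P;
      g ` carrier N = carrier P\<rbrakk> \<Longrightarrow> \<exists>h\<in>lin_hom R P N. \<forall>p\<in>carrier P. g (h p) = p"
  shows "projective R P"
proof -
  interpret left_module R P by fact
  let ?F = "free_module R (carrier P)"
  have e: "lin_ext (\<lambda>p. p) \<in> lin_hom R ?F P" by (rule lin_ext_hom)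
  have "p \<in> lin_ext (\<lambda>p. p) ` carrier ?F" if "p \<in> carrier P" for p
    using that lin_ext_unit_vec[of "\<lambda>p. p" p] R.unit_vec_closed[of p "carrier P"]
    by (metis imageI)
  then have "lin_ext (\<lambda>p. p) ` carrier ?F = carrier P" using e by (auto simp: lin_hom_def)
  then obtain h where "h \<in> lin_hom R P ?F" "\<forall>p\<in>carrier P. lin_ext (\<lambda>p. p) (h p) = p"
    using lift[OF left_module_free_module[OF R.ring_axioms] e] by blast
  then show ?thesis using assms(1) e unfolding projective_def by blast
qed

end

theory Submission
  imports Defs
begin

text \<open>
  Let \<open>S\<close> be the set of the objects \<open>y \<noteq> x\<close> with a morphism \<open>y \<rightarrow> x\<close>, let \<open>f\<close> be the sum of the
  \<open>e\<^sub>y\<close> with \<open>y \<in> S\<close>, and let \<open>e = e\<^sub>x\<close>. Composition and directedness make \<open>S\<close> closed under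
  predecessors, which says \<open>f A = f A f\<close>; moreover \<open>e A = e A e + e A f\<close>, and minimality of \<open>x\<close> says
  \<open>f M = 0\<close>. Besides \<open>e e = e\<close>, only these three facts about \<open>A\<close>, \<open>e\<close>, \<open>f\<close> and \<open>M\<close>
  matter from then on.

  If \<open>P \<rightarrow> N\<close> is a projective cover and \<open>f N = 0\<close>, then \<open>{p. f A p = 0}\<close> is a submodule of \<open>P\<close> that
  contains \<open>(1 - f) P\<close>, while \<open>f P\<close> lies in the superfluous kernel; hence \<open>f P = 0\<close>
  (\<open>cover_annihilated\<close>). Kernels inherit the vanishing, so \<open>f\<close> annihilates every term of the
  minimal resolution. Evaluation at \<open>e\<close> is exact, and on modules annihilated by \<open>f\<close> it preserves the
  other two properties:

  Projectivity (\<open>projective_eval_at\<close>): if \<open>P\<close> is a summand of a free module \<open>F\<close>, then \<open>e P\<close> is a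
  summand of \<open>e F = e F e + e F f\<close>; the projection to \<open>P\<close> kills \<open>F f\<close>
  because \<open>f P = 0\<close>, so \<open>e P\<close> is already a summand of the free \<open>e A e\<close>-module \<open>e F e\<close>.

  Superfluous submodules (\<open>superfluous_eval_at\<close>): if \<open>L + e N = e P\<close>, then the submodule
  \<open>{p. e A p \<subseteq> L}\<close> of \<open>P\<close> contains \<open>L\<close> and \<open>(1 - e) P\<close>, because \<open>e A (1 - e) P \<subseteq> e A f P = 0\<close>.
  Together with \<open>N\<close> it generates \<open>P\<close>, so it is \<open>P\<close>, and \<open>L = e P\<close>.
\<close>

section \<open>Homomorphisms and submodules over noncommutative rings\<close>

lemma lin_homD:
  assumes "f \<in> lin_hom R M N"
  shows "x \<in> carrier M \<Longrightarrow> f x \<in> carrier N"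
    and "\<lbrakk>x \<in> carrier M; y \<in> carrier M\<rbrakk> \<Longrightarrow> f (x \<oplus>\<^bsub>M\<^esub> y) = f x \<oplus>\<^bsub>N\<^esub> f y"
    and "\<lbrakk>a \<in> carrier R; x \<in> carrier M\<rbrakk> \<Longrightarrow> f (a \<odot>\<^bsub>M\<^esub> x) = a \<odot>\<^bsub>N\<^esub> f x"
  using assms by (auto simp: lin_hom_def)

context left_module
begin

lemma smult_minus_one:
  assumes "x \<in> carrier M" shows "(\<ominus> \<one>) \<odot>\<^bsub>M\<^esub> x = \<ominus>\<^bsub>M\<^esub> x"
proof -
  have "(\<ominus> \<one>) \<odot>\<^bsub>M\<^esub> x \<oplus>\<^bsub>M\<^esub> x = (\<ominus> \<one> \<oplus> \<one>) \<odot>\<^bsub>M\<^esub> x"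
    using assms smult_l_distr[of "\<ominus> \<one>" \<one> x] by simp
  also have "\<dots> = \<zero>\<^bsub>M\<^esub>" using assms by (simp add: R.l_neg)
  finally show ?thesis using assms by (simp add: M.minus_equality)
qed

lemma submoduleI:
  assumes "L \<subseteq> carrier M" "\<zero>\<^bsub>M\<^esub> \<in> L"
    and "\<And>x y. \<lbrakk>x \<in> L; y \<in> L\<rbrakk> \<Longrightarrow> x \<oplus>\<^bsub>M\<^esub> y \<in> L"
    and smult: "\<And>a x. \<lbrakk>a \<in> carrier R; x \<in> L\<rbrakk> \<Longrightarrow> a \<odot>\<^bsub>M\<^esub> x \<in> L"
  shows "submodule L R M"
proof (intro submodule.intro subgroup.intro submodule_axioms.intro)
  fix x assume "x \<in> L"
  then have "\<ominus>\<^bsub>M\<^esub> x \<in> L"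
    using smult[of "\<ominus> \<one>" x] smult_minus_one[of x] assms(1) by auto
  then show "inv\<^bsub>add_monoid M\<^esub> x \<in> L" by (simp add: a_inv_def)
qed (use assms in auto)

lemma submoduleD:
  assumes "submodule L R M"
  shows "L \<subseteq> carrier M" "\<zero>\<^bsub>M\<^esub> \<in> L"
    and "\<lbrakk>x \<in> L; y \<in> L\<rbrakk> \<Longrightarrow> x \<oplus>\<^bsub>M\<^esub> y \<in> L"
    and "\<lbrakk>a \<in> carrier R; x \<in> L\<rbrakk> \<Longrightarrow> a \<odot>\<^bsub>M\<^esub> x \<in> L"
  using submodule.axioms(1)[OF assms] submodule.smult_closed[OF assms]
  by (auto simp: subgroup_def)

end

lemma superfluousD:
  assumes "superfluous R M N" and M: "left_module R M" and L: "submodule L R M"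
    and sum: "\<And>m. m \<in> carrier M \<Longrightarrow> \<exists>l\<in>L. \<exists>n\<in>N. m = l \<oplus>\<^bsub>M\<^esub> n"
  shows "L = carrier M"
proof -
  interpret left_module R M by fact
  have "L \<subseteq> carrier M" "N \<subseteq> carrier M"
    using submoduleD(1)[OF L] submoduleD(1) assms(1) by (auto simp: superfluous_def)
  then have "L <+>\<^bsub>M\<^esub> N = carrier M"
    using sum by (auto simp: set_add_def')
  then show ?thesis using assms(1) L by (auto simp: superfluous_def)
qed

lemma projective_left_module: "projective R P \<Longrightarrow> left_module R P"
  by (simp add: projective_def)

section \<open>Evaluation at one idempotent\<close>

context ring
begin

lemma carrier_corner_ring:
  assumes "e \<in> carrier R" "e \<otimes> e = e"
  shows "carrier (corner_ring R e) = {a \<in> carrier R. e \<otimes> a = a \<and> a \<otimes> e = a}"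
proof -
  have "e \<otimes> (e \<otimes> a \<otimes> e) = e \<otimes> a \<otimes> e" "e \<otimes> a \<otimes> e \<otimes> e = e \<otimes> a \<otimes> e"
    if "a \<in> carrier R" for a
    using assms that by (metis m_assoc m_closed)+
  moreover have "\<exists>b. a = e \<otimes> b \<otimes> e \<and> b \<in> carrier R"
    if "a \<in> carrier R" "e \<otimes> a = a" "a \<otimes> e = a" for a
    using that by (intro exI[of _ a]) simp
  ultimately show ?thesis using assms by (auto simp: corner_ring_def)
qed

lemma corner_ring_simps [simp]:
  "a \<otimes>\<^bsub>corner_ring R e\<^esub> b = a \<otimes> b" "a \<oplus>\<^bsub>corner_ring R e\<^esub> b = a \<oplus> b"
  "\<zero>\<^bsub>corner_ring R e\<^esub> = \<zero>" "\<one>\<^bsub>corner_ring R e\<^esub> = e"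
  by (simp_all add: corner_ring_def)

lemma ring_corner_ring:
  assumes e: "e \<in> carrier R" "e \<otimes> e = e"
  shows "ring (corner_ring R e)"
proof (rule ringI)
  show "abelian_group (corner_ring R e)"
  proof (rule abelian_groupI)
    fix a assume "a \<in> carrier (corner_ring R e)"
    then show "\<exists>b\<in>carrier (corner_ring R e).
        b \<oplus>\<^bsub>corner_ring R e\<^esub> a = \<zero>\<^bsub>corner_ring R e\<^esub>"
      by (intro bexI[of _ "\<ominus> a"])
        (use e in \<open>auto simp: carrier_corner_ring l_neg l_minus r_minus\<close>)
  qed (use e in \<open>auto simp: carrier_corner_ring a_ac l_distr r_distr\<close>)
  show "monoid (corner_ring R e)"
  proof (rule monoidI)
    fix a b assume "a \<in> carrier (corner_ring R e)" "b \<in> carrier (corner_ring R e)"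
    then show "a \<otimes>\<^bsub>corner_ring R e\<^esub> b \<in> carrier (corner_ring R e)"
      using e by (simp add: carrier_corner_ring m_assoc) (simp add: m_assoc[symmetric])
  qed (use e in \<open>auto simp: carrier_corner_ring m_assoc\<close>)
qed (use e in \<open>auto simp: carrier_corner_ring l_distr r_distr\<close>)

end

lemma eval_at_simps [simp]:
  "a \<odot>\<^bsub>eval_at M e\<^esub> m = a \<odot>\<^bsub>M\<^esub> m" "m \<oplus>\<^bsub>eval_at M e\<^esub> m' = m \<oplus>\<^bsub>M\<^esub> m'"
  "\<zero>\<^bsub>eval_at M e\<^esub> = \<zero>\<^bsub>M\<^esub>"
  by (simp_all add: eval_at_def)

lemma (in left_module) carrier_eval_at:
  assumes "e \<in> carrier R" "e \<otimes> e = e"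
  shows "carrier (eval_at M e) = {m \<in> carrier M. e \<odot>\<^bsub>M\<^esub> m = m}"
proof -
  have "e \<odot>\<^bsub>M\<^esub> (e \<odot>\<^bsub>M\<^esub> m) = e \<odot>\<^bsub>M\<^esub> m" if "m \<in> carrier M" for m
    using smult_assoc[of e e m] assms that by simp
  then show ?thesis using assms by (auto simp: eval_at_def intro: image_eqI[OF sym])
qed

lemma (in left_module) left_module_eval_at:
  assumes e: "e \<in> carrier R" "e \<otimes> e = e"
  shows "left_module (corner_ring R e) (eval_at M e)"
proof (intro left_module.intro left_module_axioms.intro)
  note [simp] = carrier_eval_at[OF e] R.carrier_corner_ring[OF e]
  show "ring (corner_ring R e)" using e by (rule R.ring_corner_ring)
  show "abelian_group (eval_at M e)"
  proof (rule abelian_groupI)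
    fix m assume m: "m \<in> carrier (eval_at M e)"
    have "e \<odot>\<^bsub>M\<^esub> (\<ominus>\<^bsub>M\<^esub> m) \<oplus>\<^bsub>M\<^esub> m = e \<odot>\<^bsub>M\<^esub> (\<ominus>\<^bsub>M\<^esub> m \<oplus>\<^bsub>M\<^esub> m)"
      using m e smult_r_distr[of e "\<ominus>\<^bsub>M\<^esub> m" m] by simp
    also have "\<dots> = \<zero>\<^bsub>M\<^esub>" using m e by (simp add: M.l_neg)
    finally show "\<exists>m'\<in>carrier (eval_at M e). m' \<oplus>\<^bsub>eval_at M e\<^esub> m = \<zero>\<^bsub>eval_at M e\<^esub>"
      using m e smult_assoc[of e e "\<ominus>\<^bsub>M\<^esub> m"] by (intro bexI[of _ "e \<odot>\<^bsub>M\<^esub> (\<ominus>\<^bsub>M\<^esub> m)"]) auto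
  qed (use e in \<open>auto simp: M.a_ac smult_r_distr\<close>)
  fix a m assume a: "a \<in> carrier (corner_ring R e)" and m: "m \<in> carrier (eval_at M e)"
  then show "a \<odot>\<^bsub>eval_at M e\<^esub> m \<in> carrier (eval_at M e)"
    using smult_assoc[of e a m] e by simp
qed (use e in \<open>auto simp: carrier_eval_at R.carrier_corner_ring smult_l_distr smult_r_distr
    smult_assoc\<close>)

lemma lin_hom_eval_at:
  assumes M: "left_module R M" and N: "left_module R N" and f: "f \<in> lin_hom R M N"
    and e: "e \<in> carrier R" "e \<otimes>\<^bsub>R\<^esub> e = e"
  shows "f \<in> lin_hom (corner_ring R e) (eval_at M e) (eval_at N e)"
proof -
  interpret M: left_module R M by fact
  interpret N: left_module R N by fact
  show ?thesis
    using lin_homD[OF f] e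
    by (auto simp: lin_hom_def M.carrier_eval_at N.carrier_eval_at M.R.carrier_corner_ring)
      (metis)
qed

lemma image_eval_at:
  assumes f: "f \<in> lin_hom R M N" and "e \<in> carrier R"
  shows "f ` carrier (eval_at M e) = (\<lambda>y. e \<odot>\<^bsub>N\<^esub> y) ` f ` carrier M"
  using assms by (force simp: eval_at_def lin_homD image_image intro!: image_cong)

text \<open>Together with \<open>image_eval_at\<close>, this says that evaluation is exact: it commutes with
  kernels, as it does with images.\<close>

lemma kernel_eval_at:
  assumes "left_module R M" "left_module R N" and f: "f \<in> lin_hom R M N"
    and e: "e \<in> carrier R" "e \<otimes>\<^bsub>R\<^esub> e = e"
  shows "a_kernel (eval_at M e) (eval_at N e) f = (\<lambda>m. e \<odot>\<^bsub>M\<^esub> m) ` a_kernel M N f"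
proof -
  interpret M: left_module R M by fact
  interpret N: left_module R N by fact
  have "m \<in> (\<lambda>m. e \<odot>\<^bsub>M\<^esub> m) ` a_kernel M N f"
    if "m \<in> a_kernel (eval_at M e) (eval_at N e) f" for m
    using that e by (intro image_eqI[of _ _ m]) (auto simp: a_kernel_def' M.carrier_eval_at)
  moreover have "e \<odot>\<^bsub>M\<^esub> m \<in> a_kernel (eval_at M e) (eval_at N e) f"
    if "m \<in> a_kernel M N f" for m
    using that e by (auto simp: a_kernel_def' eval_at_def lin_homD[OF f])
  ultimately show ?thesis by blast
qed

section \<open>Vanishing at predecessors and evaluation\<close>

text \<open>The element \<open>e\<close> plays the role of \<open>e\<^sub>x\<close>, and \<open>f\<close> that of the sum of the idempotents at the
  other objects with a morphism to \<open>x\<close>. The assumption \<open>f_left\<close> implies that \<open>f\<close> is idempotent;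
  orthogonality of \<open>e\<close> and \<open>f\<close> is not needed.\<close>

locale predecessor_idempotent = A?: ring A
  for A :: "('a, 'r) ring_scheme" (structure) and e f :: 'a +
  assumes e_closed [simp, intro]: "e \<in> carrier A" and f_closed [simp, intro]: "f \<in> carrier A"
    and e_idem [simp]: "e \<otimes> e = e"
    and f_left: "a \<in> carrier A \<Longrightarrow> f \<otimes> a = f \<otimes> a \<otimes> f"
    and e_left: "a \<in> carrier A \<Longrightarrow> e \<otimes> a = e \<otimes> a \<otimes> e \<oplus> e \<otimes> a \<otimes> f"
begin

lemma smult_f_left:
  assumes "left_module A M" "a \<in> carrier A" "m \<in> carrier M"
  shows "f \<odot>\<^bsub>M\<^esub> (a \<odot>\<^bsub>M\<^esub> (f \<odot>\<^bsub>M\<^esub> m)) = f \<odot>\<^bsub>M\<^esub> (a \<odot>\<^bsub>M\<^esub> m)"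
proof -
  interpret left_module A M by fact
  have "f \<odot>\<^bsub>M\<^esub> (a \<odot>\<^bsub>M\<^esub> m) = (f \<otimes> a \<otimes> f) \<odot>\<^bsub>M\<^esub> m"
    using assms f_left[of a] by (simp add: smult_assoc[symmetric])
  then show ?thesis using assms by (simp add: smult_assoc)
qed

lemma smult_e_left:
  assumes "left_module A M" and "a \<in> carrier A" "m \<in> carrier M" and "f \<odot>\<^bsub>M\<^esub> m = \<zero>\<^bsub>M\<^esub>"
  shows "e \<odot>\<^bsub>M\<^esub> (a \<odot>\<^bsub>M\<^esub> (e \<odot>\<^bsub>M\<^esub> m)) = e \<odot>\<^bsub>M\<^esub> (a \<odot>\<^bsub>M\<^esub> m)"
proof -
  interpret left_module A M by fact
  have "e \<odot>\<^bsub>M\<^esub> (a \<odot>\<^bsub>M\<^esub> m) = (e \<otimes> a \<otimes> e \<oplus> e \<otimes> a \<otimes> f) \<odot>\<^bsub>M\<^esub> m"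
    using assms(2,3) e_left[of a] by (simp add: smult_assoc[symmetric])
  also have "\<dots> = e \<odot>\<^bsub>M\<^esub> (a \<odot>\<^bsub>M\<^esub> (e \<odot>\<^bsub>M\<^esub> m)) \<oplus>\<^bsub>M\<^esub> (e \<otimes> a) \<odot>\<^bsub>M\<^esub> (f \<odot>\<^bsub>M\<^esub> m)"
    using assms(2,3) by (simp add: smult_l_distr smult_assoc)
  finally show ?thesis using assms by simp
qed

lemma cover_annihilated:
  assumes cover: "projective_cover A P g N"
    and N0: "\<And>n. n \<in> carrier N \<Longrightarrow> f \<odot>\<^bsub>N\<^esub> n = \<zero>\<^bsub>N\<^esub>"
    and "p \<in> carrier P"
  shows "f \<odot>\<^bsub>P\<^esub> p = \<zero>\<^bsub>P\<^esub>"
proof -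
  have P: "left_module A P" and N: "left_module A N" and g: "g \<in> lin_hom A P N"
    and sup: "superfluous A P (a_kernel P N g)"
    using cover by (auto simp: projective_cover_def projective_left_module)
  interpret P: left_module A P by fact
  interpret N: left_module A N by fact
  define L where
    "L = {p \<in> carrier P. \<forall>a\<in>carrier A. f \<odot>\<^bsub>P\<^esub> (a \<odot>\<^bsub>P\<^esub> p) = \<zero>\<^bsub>P\<^esub>}"
  have "f \<odot>\<^bsub>P\<^esub> (b \<odot>\<^bsub>P\<^esub> (a \<odot>\<^bsub>P\<^esub> p)) = \<zero>\<^bsub>P\<^esub>"
    if "p \<in> L" "a \<in> carrier A" "b \<in> carrier A" for a b p
  proof -
    have "f \<odot>\<^bsub>P\<^esub> ((b \<otimes> a) \<odot>\<^bsub>P\<^esub> p) = \<zero>\<^bsub>P\<^esub>" using that by (simp add: L_def)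
    then show ?thesis using that by (simp add: L_def P.smult_assoc)
  qed
  then have L: "submodule L A P"
    by (intro P.submoduleI) (auto simp: L_def P.smult_r_distr)
  have "L = carrier P"
  proof (rule superfluousD[OF sup P L])
    fix p assume p: "p \<in> carrier P"
    let ?fp = "f \<odot>\<^bsub>P\<^esub> p"
    have "f \<odot>\<^bsub>P\<^esub> (a \<odot>\<^bsub>P\<^esub> (p \<ominus>\<^bsub>P\<^esub> ?fp)) = \<zero>\<^bsub>P\<^esub>" if a: "a \<in> carrier A" for a
    proof -
      let ?q = "p \<ominus>\<^bsub>P\<^esub> ?fp"
      have q: "?q \<in> carrier P" "p = ?q \<oplus>\<^bsub>P\<^esub> ?fp"
        using p by (auto simp: P.M.minus_eq P.M.a_assoc P.M.l_neg)
      have "f \<odot>\<^bsub>P\<^esub> (a \<odot>\<^bsub>P\<^esub> p) =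
          f \<odot>\<^bsub>P\<^esub> (a \<odot>\<^bsub>P\<^esub> ?q) \<oplus>\<^bsub>P\<^esub> f \<odot>\<^bsub>P\<^esub> (a \<odot>\<^bsub>P\<^esub> ?fp)"
        using p q(1) a by (subst q(2)) (simp add: P.smult_r_distr)
      then show ?thesis
        unfolding smult_f_left[OF P a p] using a p q(1) by (simp add: P.M.add.l_cancel_one')
    qed
    then have "p \<ominus>\<^bsub>P\<^esub> ?fp \<in> L" using p by (simp add: L_def)
    moreover have "?fp \<in> a_kernel P N g"
      using p by (simp add: a_kernel_def' lin_homD[OF g] N0)
    moreover have "p = (p \<ominus>\<^bsub>P\<^esub> ?fp) \<oplus>\<^bsub>P\<^esub> ?fp"
      using p by (simp add: P.M.minus_eq P.M.a_assoc P.M.l_neg)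
    ultimately show "\<exists>l\<in>L. \<exists>k\<in>a_kernel P N g. p = l \<oplus>\<^bsub>P\<^esub> k" by blast
  qed
  then have "p \<in> L" using assms(3) by simp
  then have "f \<odot>\<^bsub>P\<^esub> (\<one> \<odot>\<^bsub>P\<^esub> p) = \<zero>\<^bsub>P\<^esub>" using A.one_closed unfolding L_def by blast
  then show ?thesis using assms(3) by simp
qed

lemma superfluous_eval_at:
  assumes sup: "superfluous A P N" and P: "left_module A P"
    and P0: "\<And>p. p \<in> carrier P \<Longrightarrow> f \<odot>\<^bsub>P\<^esub> p = \<zero>\<^bsub>P\<^esub>"
  shows "superfluous (corner_ring A e) (eval_at P e) ((\<lambda>p. e \<odot>\<^bsub>P\<^esub> p) ` N)"
  unfolding superfluous_def
proof (intro conjI allI impI)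
  interpret P: left_module A P by fact
  interpret eP: left_module "corner_ring A e" "eval_at P e" by (rule P.left_module_eval_at) auto
  note carr = P.carrier_eval_at[OF e_closed e_idem] A.carrier_corner_ring[OF e_closed e_idem]
  have subN: "submodule N A P" using sup by (simp add: superfluous_def)
  note ND = P.submoduleD[OF subN]
  show "submodule ((\<lambda>p. e \<odot>\<^bsub>P\<^esub> p) ` N) (corner_ring A e) (eval_at P e)"
  proof (rule eP.submoduleI)
    show "(\<lambda>p. e \<odot>\<^bsub>P\<^esub> p) ` N \<subseteq> carrier (eval_at P e)"
      using ND(1) by (auto simp: eval_at_def)
    show "\<zero>\<^bsub>eval_at P e\<^esub> \<in> (\<lambda>p. e \<odot>\<^bsub>P\<^esub> p) ` N"
      using ND(2) by (intro image_eqI[of _ _ "\<zero>\<^bsub>P\<^esub>"]) auto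
  next
    fix p q assume "p \<in> (\<lambda>p. e \<odot>\<^bsub>P\<^esub> p) ` N" "q \<in> (\<lambda>p. e \<odot>\<^bsub>P\<^esub> p) ` N"
    then obtain m n where mn: "m \<in> N" "n \<in> N" "p = e \<odot>\<^bsub>P\<^esub> m" "q = e \<odot>\<^bsub>P\<^esub> n" by blast
    then have "p \<oplus>\<^bsub>P\<^esub> q = e \<odot>\<^bsub>P\<^esub> (m \<oplus>\<^bsub>P\<^esub> n)"
      using ND(1) by (simp add: P.smult_r_distr subset_iff)
    then show "p \<oplus>\<^bsub>eval_at P e\<^esub> q \<in> (\<lambda>p. e \<odot>\<^bsub>P\<^esub> p) ` N" using ND(3)[OF mn(1,2)] by simp
  next
    fix a p assume a: "a \<in> carrier (corner_ring A e)" and "p \<in> (\<lambda>p. e \<odot>\<^bsub>P\<^esub> p) ` N"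
    then obtain m where m: "m \<in> N" "p = e \<odot>\<^bsub>P\<^esub> m" by blast
    have ae: "a \<in> carrier A" "e \<otimes> a = a" "a \<otimes> e = a" using a by (auto simp: carr)
    have "m \<in> carrier P" using m ND(1) by auto
    then have "a \<odot>\<^bsub>P\<^esub> p = e \<odot>\<^bsub>P\<^esub> (a \<odot>\<^bsub>P\<^esub> m)"
      using P.smult_assoc[of a e m] P.smult_assoc[of e a m] ae m(2) by simp
    then show "a \<odot>\<^bsub>eval_at P e\<^esub> p \<in> (\<lambda>p. e \<odot>\<^bsub>P\<^esub> p) ` N" using ND(4)[OF ae(1) m(1)] by simp
  qed
  fix L assume "submodule L (corner_ring A e) (eval_at P e) \<and>
    L <+>\<^bsub>eval_at P e\<^esub> (\<lambda>p. e \<odot>\<^bsub>P\<^esub> p) ` N = carrier (eval_at P e)"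
  then have L: "submodule L (corner_ring A e) (eval_at P e)"
    and sum: "L <+>\<^bsub>eval_at P e\<^esub> (\<lambda>p. e \<odot>\<^bsub>P\<^esub> p) ` N = carrier (eval_at P e)" by auto
  note LD = eP.submoduleD[OF L, unfolded eval_at_simps]
  have L_carr: "l \<in> carrier P" "e \<odot>\<^bsub>P\<^esub> l = l" if "l \<in> L" for l
    using LD(1) that by (auto simp: carr)
  define L' where "L' = {p \<in> carrier P. \<forall>a\<in>carrier A. e \<odot>\<^bsub>P\<^esub> (a \<odot>\<^bsub>P\<^esub> p) \<in> L}"
  have "e \<odot>\<^bsub>P\<^esub> (b \<odot>\<^bsub>P\<^esub> (a \<odot>\<^bsub>P\<^esub> p)) \<in> L"
    if "p \<in> L'" "a \<in> carrier A" "b \<in> carrier A" for a b p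
  proof -
    have "e \<odot>\<^bsub>P\<^esub> ((b \<otimes> a) \<odot>\<^bsub>P\<^esub> p) \<in> L" using that by (auto simp: L'_def)
    then show ?thesis using that by (simp add: L'_def P.smult_assoc)
  qed
  then have L': "submodule L' A P"
    by (intro P.submoduleI) (auto simp: L'_def P.smult_r_distr LD)
  have in_L': "p \<in> L'" if p: "p \<in> carrier P" "e \<odot>\<^bsub>P\<^esub> p \<in> L" for p
  proof -
    have "e \<odot>\<^bsub>P\<^esub> (a \<odot>\<^bsub>P\<^esub> p) \<in> L" if a: "a \<in> carrier A" for a
    proof -
      have "e \<otimes> a \<otimes> e \<in> carrier (corner_ring A e)" using a by (auto simp: corner_ring_def)
      then have "(e \<otimes> a \<otimes> e) \<odot>\<^bsub>P\<^esub> (e \<odot>\<^bsub>P\<^esub> p) \<in> L" using LD(4) p(2) by blast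
      then have "e \<odot>\<^bsub>P\<^esub> (a \<odot>\<^bsub>P\<^esub> (e \<odot>\<^bsub>P\<^esub> p)) \<in> L"
        using a p by (simp add: P.smult_assoc L_carr(2))
      then show ?thesis using smult_e_left[OF P a p(1) P0[OF p(1)]] by simp
    qed
    then show ?thesis using p by (simp add: L'_def)
  qed
  have "L' = carrier P"
  proof (rule superfluousD[OF sup P L'])
    fix p assume p: "p \<in> carrier P"
    then have "e \<odot>\<^bsub>P\<^esub> p \<in> carrier (eval_at P e)" by (simp add: eval_at_def)
    then obtain l n where l: "l \<in> L" and n: "n \<in> N" and eq: "e \<odot>\<^bsub>P\<^esub> p = l \<oplus>\<^bsub>P\<^esub> e \<odot>\<^bsub>P\<^esub> n"
      unfolding sum[symmetric] by (auto simp: set_add_def')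
    have nP: "n \<in> carrier P" using n ND(1) by auto
    let ?q = "p \<ominus>\<^bsub>P\<^esub> n"
    have q: "?q \<in> carrier P" "p = ?q \<oplus>\<^bsub>P\<^esub> n"
      using p nP by (auto simp: P.M.minus_eq P.M.a_assoc P.M.l_neg)
    have "e \<odot>\<^bsub>P\<^esub> ?q \<oplus>\<^bsub>P\<^esub> e \<odot>\<^bsub>P\<^esub> n = l \<oplus>\<^bsub>P\<^esub> e \<odot>\<^bsub>P\<^esub> n"
      using q nP P.smult_r_distr[of e ?q n] eq by simp
    then have "e \<odot>\<^bsub>P\<^esub> ?q = l"
      using q(1) nP L_carr(1)[OF l] by (simp add: P.M.add.right_cancel)
    then have "?q \<in> L'" using in_L' q(1) l by simp
    then show "\<exists>l\<in>L'. \<exists>n\<in>N. p = l \<oplus>\<^bsub>P\<^esub> n" using q(2) n by blast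
  qed
  have "p \<in> L" if p: "p \<in> carrier (eval_at P e)" for p
  proof -
    have "p \<in> L'" using p \<open>L' = carrier P\<close> by (simp add: carr)
    then have "e \<odot>\<^bsub>P\<^esub> (\<one> \<odot>\<^bsub>P\<^esub> p) \<in> L" unfolding L'_def by blast
    then show ?thesis using p by (simp add: carr)
  qed
  then show "L = carrier (eval_at P e)" using LD(1) by auto
qed

lemma right_mult_free_module:
  assumes "c \<in> carrier A"
  shows "(\<lambda>v i. v i \<otimes> c) \<in> lin_hom A (free_module A I) (free_module A I)"
proof -
  have "finite {i. v i \<otimes> c \<noteq> \<zero>}" if "finite {i. v i \<noteq> \<zero>}" for v :: "'i \<Rightarrow> 'a"
    by (rule finite_subset[OF _ that]) (use assms in auto)
  then show ?thesis using assms by (auto simp: lin_hom_def free_module_def l_distr m_assoc)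
qed

text \<open>A homomorphism from a free module \<open>F\<close> to a module annihilated by \<open>f\<close> vanishes on \<open>F f\<close>, even
  though \<open>F f\<close> is formed by multiplication on the other side: unit vectors commute with \<open>f\<close>.\<close>

lemma free_module_hom_annihilated:
  assumes P: "left_module A P" and P0: "\<And>p. p \<in> carrier P \<Longrightarrow> f \<odot>\<^bsub>P\<^esub> p = \<zero>\<^bsub>P\<^esub>"
    and r: "r \<in> lin_hom A (free_module A I) P" and v: "v \<in> carrier (free_module A I)"
  shows "r (\<lambda>i. v i \<otimes> f) = \<zero>\<^bsub>P\<^esub>"
proof -
  interpret P: left_module A P by fact
  let ?F = "free_module A I"
  have z: "(\<lambda>_. \<zero>\<^bsub>P\<^esub>) \<in> lin_hom A ?F P" by (auto simp: lin_hom_def)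
  have "r (\<lambda>j. unit_vec A i j \<otimes> f) = \<zero>\<^bsub>P\<^esub>" if i: "i \<in> I" for i
  proof -
    have u: "unit_vec A i \<in> carrier ?F" using i by (rule A.unit_vec_closed)
    have "(\<lambda>j. unit_vec A i j \<otimes> f) = f \<odot>\<^bsub>?F\<^esub> unit_vec A i"
      by (auto simp: unit_vec_def free_module_def)
    then show ?thesis using lin_homD(3)[OF r f_closed u] P0[OF lin_homD(1)[OF r u]] by simp
  qed
  then show ?thesis
    by (rule free_module_hom_eq[OF P lin_hom_comp[OF right_mult_free_module[OF f_closed] r] z _ v])
qed

lemma projective_eval_at:
  fixes P :: "('a, 'm, 's) module_scheme"
  assumes proj: "projective A P" and P0: "\<And>p. p \<in> carrier P \<Longrightarrow> f \<odot>\<^bsub>P\<^esub> p = \<zero>\<^bsub>P\<^esub>"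
  shows "projective (corner_ring A e) (eval_at P e)"
proof -
  have P: "left_module A P" using proj by (rule projective_left_module)
  interpret P: left_module A P by fact
  note carr = P.carrier_eval_at[OF e_closed e_idem] A.carrier_corner_ring[OF e_closed e_idem]
  from proj obtain I :: "'m set" and s r where s: "s \<in> lin_hom A P (free_module A I)"
    and r: "r \<in> lin_hom A (free_module A I) P" and rs: "\<And>p. p \<in> carrier P \<Longrightarrow> r (s p) = p"
    unfolding projective_def by blast
  let ?B = "corner_ring A e" and ?F = "free_module A I" and ?F' = "free_module (corner_ring A e) I"
  let ?s = "\<lambda>p i. s p i \<otimes> e"
  have F': "v \<in> carrier ?F" "e \<odot>\<^bsub>?F\<^esub> v = v" if "v \<in> carrier ?F'" for v
    using that by (auto simp: free_module_def carr)
  have ops: "v \<oplus>\<^bsub>?F'\<^esub> w = v \<oplus>\<^bsub>?F\<^esub> w" "a \<odot>\<^bsub>?F'\<^esub> v = a \<odot>\<^bsub>?F\<^esub> v" for a v w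
    by (auto simp: free_module_def)
  have es: "e \<otimes> s p i = s p i" "s p i \<in> carrier A" if p: "p \<in> carrier (eval_at P e)" for p i
  proof -
    have "s p = e \<odot>\<^bsub>?F\<^esub> s p" using lin_homD(3)[OF s e_closed, of p] p by (simp add: carr)
    then show "e \<otimes> s p i = s p i" unfolding free_module_def by (auto dest: fun_cong[of _ _ i])
    show "s p i \<in> carrier A" using lin_homD(1)[OF s, of p] p by (auto simp: carr free_module_def)
  qed
  have s1: "?s \<in> lin_hom A P ?F"
    using lin_hom_comp[OF s right_mult_free_module[OF e_closed]] .
  have "?s p \<in> carrier ?F'" if p: "p \<in> carrier (eval_at P e)" for p
  proof -
    have "?s p \<in> carrier ?F" using lin_homD(1)[OF s1] p by (simp add: carr)
    moreover have "s p i \<otimes> e \<in> carrier ?B" for i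
      using es[OF p, of i] by (simp add: carr m_assoc) (simp add: m_assoc[symmetric])
    ultimately show ?thesis by (simp add: free_module_def)
  qed
  then have s': "?s \<in> lin_hom ?B (eval_at P e) ?F'"
    using lin_homD(2,3)[OF s1] by (auto simp: lin_hom_def ops carr)
  have "r v \<in> carrier (eval_at P e)" if v: "v \<in> carrier ?F'" for v
    using lin_homD(1)[OF r F'(1)[OF v]] lin_homD(3)[OF r e_closed F'(1)[OF v]] F'(2)[OF v]
    by (simp add: carr)
  then have r': "r \<in> lin_hom ?B ?F' (eval_at P e)"
    using lin_homD(2,3)[OF r] F'(1) by (auto simp: lin_hom_def ops carr)
  have "r (?s p) = p" if p: "p \<in> carrier (eval_at P e)" for p
  proof -
    have pP: "p \<in> carrier P" using p by (simp add: carr)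
    let ?w = "\<lambda>i. s p i \<otimes> f"
    have w: "?w \<in> carrier ?F"
      using lin_homD(1)[OF right_mult_free_module[OF f_closed] lin_homD(1)[OF s pP]] .
    have "s p i = s p i \<otimes> e \<oplus> s p i \<otimes> f" for i
      using e_left[of "s p i"] es[OF p, of i] by simp
    then have "s p = ?s p \<oplus>\<^bsub>?F\<^esub> ?w" by (simp add: free_module_def)
    then have "r (s p) = r (?s p) \<oplus>\<^bsub>P\<^esub> r ?w"
      using lin_homD(2)[OF r lin_homD(1)[OF s1 pP] w] by simp
    then show ?thesis
      using rs[OF pP] lin_homD(1)[OF r lin_homD(1)[OF s1 pP]]
        free_module_hom_annihilated[OF P P0 r lin_homD(1)[OF s pP]] by simp
  qed
  then show ?thesis
    using s' r' P.left_module_eval_at[OF e_closed e_idem] unfolding projective_def by blast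
qed

lemma projective_cover_eval_at:
  assumes cover: "projective_cover A P g N"
    and N0: "\<And>n. n \<in> carrier N \<Longrightarrow> f \<odot>\<^bsub>N\<^esub> n = \<zero>\<^bsub>N\<^esub>"
  shows "projective_cover (corner_ring A e) (eval_at P e) g (eval_at N e)"
proof -
  have P: "left_module A P" and N: "left_module A N" and g: "g \<in> lin_hom A P N"
    and sup: "superfluous A P (a_kernel P N g)" and proj: "projective A P"
    and surj: "g ` carrier P = carrier N"
    using cover by (auto simp: projective_cover_def projective_left_module)
  interpret P: left_module A P by fact
  interpret N: left_module A N by fact
  have eN: "left_module (corner_ring A e) (eval_at N e)" by (rule N.left_module_eval_at) auto
  have eg: "g \<in> lin_hom (corner_ring A e) (eval_at P e) (eval_at N e)"
    by (rule lin_hom_eval_at[OF P N g]) auto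
  have P0: "f \<odot>\<^bsub>P\<^esub> p = \<zero>\<^bsub>P\<^esub>" if "p \<in> carrier P" for p
    by (rule cover_annihilated[OF cover N0 that])
  have ker: "a_kernel (eval_at P e) (eval_at N e) g = (\<lambda>p. e \<odot>\<^bsub>P\<^esub> p) ` a_kernel P N g"
    by (rule kernel_eval_at[OF P N g]) auto
  have "superfluous (corner_ring A e) (eval_at P e) (a_kernel (eval_at P e) (eval_at N e) g)"
    unfolding ker by (rule superfluous_eval_at[OF sup P P0])
  moreover have "g ` carrier (eval_at P e) = carrier (eval_at N e)"
    using image_eval_at[OF g e_closed] surj by (simp add: eval_at_def)
  ultimately show ?thesis
    using projective_eval_at[OF proj P0] eN eg unfolding projective_cover_def by blast
qed

theorem minimal_projective_resolution_eval_at: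
  assumes res: "minimal_projective_resolution A P d \<epsilon> M"
    and M0: "\<And>m. m \<in> carrier M \<Longrightarrow> f \<odot>\<^bsub>M\<^esub> m = \<zero>\<^bsub>M\<^esub>"
  shows "minimal_projective_resolution (corner_ring A e) (\<lambda>i. eval_at (P i) e) d \<epsilon> (eval_at M e)"
proof -
  have M: "left_module A M" and proj: "\<And>i. projective A (P i)"
    and eps: "\<epsilon> \<in> lin_hom A (P 0) M" and d: "\<And>i. d i \<in> lin_hom A (P (Suc i)) (P i)"
    and surj: "\<epsilon> ` carrier (P 0) = carrier M"
    and exact0: "d 0 ` carrier (P 1) = a_kernel (P 0) M \<epsilon>"
    and exact: "\<And>i. d (Suc i) ` carrier (P (Suc (Suc i))) = a_kernel (P (Suc i)) (P i) (d i)"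
    and cover0: "projective_cover A (P 0) \<epsilon> M"
    and cover: "\<And>i. projective_cover A (P (Suc i)) (d i)
           ((P i)\<lparr>carrier := d i ` carrier (P (Suc i))\<rparr>)"
    using res by (auto simp: minimal_projective_resolution_def projective_resolution_def)
  have P: "left_module A (P i)" for i using proj by (rule projective_left_module)
  have P0: "f \<odot>\<^bsub>P i\<^esub> p = \<zero>\<^bsub>P i\<^esub>" if "p \<in> carrier (P i)" for i p
    using that
  proof (induction i arbitrary: p)
    case 0
    show ?case by (rule cover_annihilated[OF cover0 M0 0])
  next
    case (Suc i)
    show ?case
      by (rule cover_annihilated[OF cover _ Suc.prems]) (use Suc.IH lin_homD(1)[OF d] in auto)
  qed
  have im: "d i ` carrier (eval_at (P (Suc i)) e) =
      (\<lambda>p. e \<odot>\<^bsub>P i\<^esub> p) ` d i ` carrier (P (Suc i))" for i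
    by (rule image_eval_at[OF d e_closed])
  have cover_e: "projective_cover (corner_ring A e) (eval_at (P (Suc i)) e) (d i)
      ((eval_at (P i) e)\<lparr>carrier := d i ` carrier (eval_at (P (Suc i)) e)\<rparr>)" for i
  proof -
    have "(eval_at (P i) e)\<lparr>carrier := d i ` carrier (eval_at (P (Suc i)) e)\<rparr> =
        eval_at ((P i)\<lparr>carrier := d i ` carrier (P (Suc i))\<rparr>) e"
      unfolding im by (simp add: eval_at_def)
    then show ?thesis
      using projective_cover_eval_at[OF cover, of i] P0 lin_homD(1)[OF d] by fastforce
  qed
  have "projective_resolution (corner_ring A e) (\<lambda>i. eval_at (P i) e) d \<epsilon> (eval_at M e)"
    unfolding projective_resolution_def
  proof (intro conjI allI)
    show "left_module (corner_ring A e) (eval_at M e)"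
      using M by (rule left_module.left_module_eval_at) auto
    show "projective (corner_ring A e) (eval_at (P i) e)" for i
      by (rule projective_eval_at[OF proj P0])
    show "\<epsilon> \<in> lin_hom (corner_ring A e) (eval_at (P 0) e) (eval_at M e)"
      by (rule lin_hom_eval_at[OF P M eps]) auto
    show "d i \<in> lin_hom (corner_ring A e) (eval_at (P (Suc i)) e) (eval_at (P i) e)" for i
      by (rule lin_hom_eval_at[OF P P d]) auto
    show "\<epsilon> ` carrier (eval_at (P 0) e) = carrier (eval_at M e)"
      using image_eval_at[OF eps e_closed] surj by (simp add: eval_at_def)
    show "d 0 ` carrier (eval_at (P 1) e) = a_kernel (eval_at (P 0) e) (eval_at M e) \<epsilon>"
      using im[of 0] exact0 kernel_eval_at[OF P M eps e_closed e_idem] by simp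
    show "d (Suc i) ` carrier (eval_at (P (Suc (Suc i))) e) =
        a_kernel (eval_at (P (Suc i)) e) (eval_at (P i) e) (d i)" for i
      using im[of "Suc i"] exact[of i] kernel_eval_at[OF P P d e_closed e_idem] by simp
  qed
  then show ?thesis
    using projective_cover_eval_at[OF cover0 M0] cover_e
    by (simp add: minimal_projective_resolution_def)
qed

end

section \<open>Morphisms of the associated category\<close>

lemma (in fin_dim_algebra) is_basis_zero_space:
  assumes "\<zero>\<^bsub>A\<^esub> \<in> W" "is_basis K A W B"
  shows "B = {} \<longleftrightarrow> W = {\<zero>\<^bsub>A\<^esub>}"
proof
  assume "B = {}"
  have "v = \<zero>\<^bsub>A\<^esub>" if v: "v \<in> W" for v
  proof -
    obtain c where "v = (\<Oplus>\<^bsub>A\<^esub>b\<in>B. c b \<odot>\<^bsub>A\<^esub> b)"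
      using assms(2) v unfolding is_basis_def by blast
    then show ?thesis using \<open>B = {}\<close> by simp
  qed
  then show "W = {\<zero>\<^bsub>A\<^esub>}" using assms(1) by blast
next
  assume W: "W = {\<zero>\<^bsub>A\<^esub>}"
  show "B = {}"
  proof (rule ccontr)
    assume "B \<noteq> {}"
    moreover have "B \<subseteq> W" using assms(2) unfolding is_basis_def by blast
    ultimately have B: "B = {\<zero>\<^bsub>A\<^esub>}" using W by blast
    \<comment> \<open>The zero vector as sole basis element would have every scalar as a coordinate.\<close>
    let ?c = "\<lambda>k. \<lambda>b\<in>B. k"
    define Q where "Q = (\<lambda>c. c \<in> B \<rightarrow>\<^sub>E carrier K \<and> \<zero>\<^bsub>A\<^esub> = (\<Oplus>\<^bsub>A\<^esub>b\<in>B. c b \<odot>\<^bsub>A\<^esub> b))"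
    have "\<exists>!c. Q c" using assms unfolding is_basis_def Q_def by blast
    moreover have "Q (?c k)" if "k \<in> carrier K" for k
      using that by (simp add: Q_def B smult_r_null)
    then have "Q (?c \<zero>\<^bsub>K\<^esub>)" "Q (?c \<one>\<^bsub>K\<^esub>)" by auto
    ultimately have "?c \<zero>\<^bsub>K\<^esub> = ?c \<one>\<^bsub>K\<^esub>" by blast
    then have "\<zero>\<^bsub>K\<^esub> = \<one>\<^bsub>K\<^esub>" by (metis B restrict_apply' singletonI)
    then show False by simp
  qed
qed

lemma hom_set_empty_iff:
  assumes "fin_dim_algebra K A" "associated_category K A n e C"
    and ij: "i \<in> {1..n}" "j \<in> {1..n}" and closed: "e i \<in> carrier A" "e j \<in> carrier A"
  shows "hom_set C i j = {} \<longleftrightarrow> (\<forall>a\<in>carrier A. e j \<otimes>\<^bsub>A\<^esub> a \<otimes>\<^bsub>A\<^esub> e i = \<zero>\<^bsub>A\<^esub>)"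
proof -
  interpret fin_dim_algebra K A by fact
  let ?W = "{e j \<otimes>\<^bsub>A\<^esub> a \<otimes>\<^bsub>A\<^esub> e i | a. a \<in> carrier A}"
  obtain B \<beta> where B: "is_basis K A ?W B" "bij_betw \<beta> (hom_set C i j) B"
    using assms(2) ij unfolding associated_category_def by blast
  have z: "\<zero>\<^bsub>A\<^esub> \<in> ?W" using closed by (auto intro!: exI[of _ "\<zero>\<^bsub>A\<^esub>"])
  have "hom_set C i j = {} \<longleftrightarrow> B = {}" using B(2) by (auto simp: bij_betw_def)
  also have "\<dots> \<longleftrightarrow> ?W = {\<zero>\<^bsub>A\<^esub>}" by (rule is_basis_zero_space[OF z B(1)])
  also have "\<dots> \<longleftrightarrow> (\<forall>a\<in>carrier A. e j \<otimes>\<^bsub>A\<^esub> a \<otimes>\<^bsub>A\<^esub> e i = \<zero>\<^bsub>A\<^esub>)"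
    using z by blast
  finally show ?thesis .
qed

lemma (in ring) finsum_sandwich_zero:
  assumes "finite T" "finite U" "p \<in> T \<rightarrow> carrier R" "q \<in> U \<rightarrow> carrier R" "a \<in> carrier R"
    and "\<And>i j. \<lbrakk>i \<in> T; j \<in> U\<rbrakk> \<Longrightarrow> p i \<otimes> a \<otimes> q j = \<zero>"
  shows "(\<Oplus>i\<in>T. p i) \<otimes> a \<otimes> (\<Oplus>j\<in>U. q j) = \<zero>"
proof -
  have q: "(\<Oplus>j\<in>U. q j) \<in> carrier R" using assms(4) by (rule finsum_closed)
  have 1: "p i \<otimes> a \<otimes> (\<Oplus>j\<in>U. q j) = \<zero>" if "i \<in> T" for i
  proof -
    have "p i \<otimes> a \<otimes> (\<Oplus>j\<in>U. q j) = (\<Oplus>j\<in>U. p i \<otimes> a \<otimes> q j)"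
      using assms that by (intro finsum_rdistr) auto
    also have "\<dots> = (\<Oplus>j\<in>U. \<zero>)" using assms(6) that by (intro finsum_cong') auto
    finally show ?thesis by simp
  qed
  have "(\<Oplus>i\<in>T. p i) \<otimes> a \<otimes> (\<Oplus>j\<in>U. q j) = (\<Oplus>i\<in>T. p i) \<otimes> (a \<otimes> (\<Oplus>j\<in>U. q j))"
    using assms q finsum_closed[OF assms(3)] by (simp add: m_assoc)
  also have "\<dots> = (\<Oplus>i\<in>T. p i \<otimes> (a \<otimes> (\<Oplus>j\<in>U. q j)))"
    using assms q by (intro finsum_ldistr) auto
  also have "\<dots> = (\<Oplus>i\<in>T. \<zero>)"
    using assms q 1 by (intro finsum_cong') (auto simp: m_assoc[symmetric] Pi_def)
  finally show ?thesis by simp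
qed

lemma (in left_module) finsum_smult_zero:
  assumes "finite T" "p \<in> T \<rightarrow> carrier R" "m \<in> carrier M"
    and "\<And>i. i \<in> T \<Longrightarrow> p i \<odot>\<^bsub>M\<^esub> m = \<zero>\<^bsub>M\<^esub>"
  shows "(\<Oplus>i\<in>T. p i) \<odot>\<^bsub>M\<^esub> m = \<zero>\<^bsub>M\<^esub>"
  using assms
proof (induction T rule: finite_induct)
  case (insert i T)
  then have "p i \<in> carrier R" "p \<in> T \<rightarrow> carrier R" by auto
  with insert show ?case by (simp add: smult_l_distr R.finsum_closed)
qed simp

lemma predecessor_idempotent_sum:
  assumes alg: "fin_dim_algebra K A" and strat: "directed_stratification A n e"
    and cat: "associated_category K A n e C" and x: "x \<in> {1..n}"
  defines "S \<equiv> {y \<in> {1..n}. y \<noteq> x \<and> hom_set C y x \<noteq> {}}"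
  shows "predecessor_idempotent A (e x) (\<Oplus>\<^bsub>A\<^esub>y\<in>S. e y)"
proof -
  interpret fin_dim_algebra K A by fact
  have closed: "e i \<in> carrier A" and idem: "e i \<otimes>\<^bsub>A\<^esub> e i = e i" if "i \<in> {1..n}" for i
    using strat that by (auto simp: directed_stratification_def)
  have one: "(\<Oplus>\<^bsub>A\<^esub>i\<in>{1..n}. e i) = \<one>\<^bsub>A\<^esub>"
    using strat by (simp add: directed_stratification_def)
  have directed: "e i \<otimes>\<^bsub>A\<^esub> a \<otimes>\<^bsub>A\<^esub> e j = \<zero>\<^bsub>A\<^esub>"
    if "i \<in> {1..n}" "j \<in> {1..n}" "i < j" "a \<in> carrier A" for i j a
    using strat that unfolding directed_stratification_def by blast
  have empty: "hom_set C i j = {} \<longleftrightarrow>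
      (\<forall>a\<in>carrier A. e j \<otimes>\<^bsub>A\<^esub> a \<otimes>\<^bsub>A\<^esub> e i = \<zero>\<^bsub>A\<^esub>)"
    if "i \<in> {1..n}" "j \<in> {1..n}" for i j
    by (rule hom_set_empty_iff[OF alg cat that closed[OF that(1)] closed[OF that(2)]])
  have increasing: "i \<le> j" if "i \<in> {1..n}" "j \<in> {1..n}" "hom_set C i j \<noteq> {}" for i j
    using empty[of i j] directed[of j i] that by (meson not_le)
  have S: "finite S" "S \<subseteq> {1..n}" by (auto simp: S_def)
  \<comment> \<open>Composition gives a morphism \<open>z \<rightarrow> x\<close>. Were \<open>z = x\<close>, there would be morphisms between \<open>x\<close> and
    \<open>y\<close> in both directions, which directedness excludes.\<close>
  have pred: "z \<in> S" if "y \<in> S" "z \<in> {1..n}" and zy: "hom_set C z y \<noteq> {}" for y z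
  proof -
    have y: "y \<in> {1..n}" "y \<noteq> x" "hom_set C y x \<noteq> {}" using that(1) by (auto simp: S_def)
    obtain g h where "g \<in> hom_set C z y" "h \<in> hom_set C y x" using zy y(3) by auto
    then have "Comp C h g \<in> hom_set C z x"
      using cat finite_category.compose_hom unfolding associated_category_def by metis
    moreover have "z \<noteq> x" using increasing[OF that(2) y(1) zy] increasing[OF y(1) x y(3)] y(2)
      by auto
    ultimately show ?thesis using that(2) by (auto simp: S_def)
  qed
  let ?f = "\<Oplus>\<^bsub>A\<^esub>y\<in>S. e y" and ?h = "\<Oplus>\<^bsub>A\<^esub>y\<in>{1..n} - S. e y"
    and ?h' = "\<Oplus>\<^bsub>A\<^esub>y\<in>{1..n} - S - {x}. e y"
  have c: "?f \<in> carrier A" "?h \<in> carrier A" "?h' \<in> carrier A" "e x \<in> carrier A"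
    using S x closed by (auto intro!: finsum_closed)
  have "(\<Oplus>\<^bsub>A\<^esub>y\<in>S \<union> ({1..n} - S). e y) = ?f \<oplus>\<^bsub>A\<^esub> ?h"
    by (rule A.finsum_Un_disjoint) (use S closed in auto)
  moreover have "S \<union> ({1..n} - S) = {1..n}" using S by auto
  ultimately have fh: "\<one>\<^bsub>A\<^esub> = ?f \<oplus>\<^bsub>A\<^esub> ?h" using one by simp
  have "(\<Oplus>\<^bsub>A\<^esub>y\<in>insert x ({1..n} - S - {x}). e y) = e x \<oplus>\<^bsub>A\<^esub> ?h'"
    by (rule A.finsum_insert) (use c closed in auto)
  moreover have "insert x ({1..n} - S - {x}) = {1..n} - S" using x by (auto simp: S_def)
  ultimately have h: "?h = e x \<oplus>\<^bsub>A\<^esub> ?h'" by simp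
  show ?thesis
  proof (intro predecessor_idempotent.intro predecessor_idempotent_axioms.intro A.ring_axioms c)
    show "e x \<otimes>\<^bsub>A\<^esub> e x = e x" using idem x .
    fix a assume a: "a \<in> carrier A"
    have h0: "?f \<otimes>\<^bsub>A\<^esub> a \<otimes>\<^bsub>A\<^esub> ?h = \<zero>\<^bsub>A\<^esub>"
    proof (rule A.finsum_sandwich_zero)
      fix y z assume y: "y \<in> S" and z: "z \<in> {1..n} - S"
      then have "hom_set C z y = {}" using pred by blast
      then show "e y \<otimes>\<^bsub>A\<^esub> a \<otimes>\<^bsub>A\<^esub> e z = \<zero>\<^bsub>A\<^esub>"
        using empty[of z y] y z S(2) a by blast
    qed (use S closed a in auto)
    have "?f \<otimes>\<^bsub>A\<^esub> a = ?f \<otimes>\<^bsub>A\<^esub> a \<otimes>\<^bsub>A\<^esub> (?f \<oplus>\<^bsub>A\<^esub> ?h)"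
      unfolding fh[symmetric] using a c(1) by simp
    also have "\<dots> = ?f \<otimes>\<^bsub>A\<^esub> a \<otimes>\<^bsub>A\<^esub> ?f" using a c h0 by (simp add: A.r_distr)
    finally show "?f \<otimes>\<^bsub>A\<^esub> a = ?f \<otimes>\<^bsub>A\<^esub> a \<otimes>\<^bsub>A\<^esub> ?f" .
    have "(\<Oplus>\<^bsub>A\<^esub>y\<in>{x}. e y) \<otimes>\<^bsub>A\<^esub> a \<otimes>\<^bsub>A\<^esub> ?h' = \<zero>\<^bsub>A\<^esub>"
    proof (rule A.finsum_sandwich_zero)
      fix y z assume "y \<in> {x}" "z \<in> {1..n} - S - {x}"
      then show "e y \<otimes>\<^bsub>A\<^esub> a \<otimes>\<^bsub>A\<^esub> e z = \<zero>\<^bsub>A\<^esub>"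
        using empty[of z x] x a by (auto simp: S_def)
    qed (use S closed a x in auto)
    then have h'0: "e x \<otimes>\<^bsub>A\<^esub> a \<otimes>\<^bsub>A\<^esub> ?h' = \<zero>\<^bsub>A\<^esub>" using c by simp
    have "e x \<otimes>\<^bsub>A\<^esub> a = e x \<otimes>\<^bsub>A\<^esub> a \<otimes>\<^bsub>A\<^esub> (?f \<oplus>\<^bsub>A\<^esub> (e x \<oplus>\<^bsub>A\<^esub> ?h'))"
      unfolding h[symmetric] fh[symmetric] using a c(4) by simp
    also have "\<dots> = e x \<otimes>\<^bsub>A\<^esub> a \<otimes>\<^bsub>A\<^esub> ?f \<oplus>\<^bsub>A\<^esub> e x \<otimes>\<^bsub>A\<^esub> a \<otimes>\<^bsub>A\<^esub> e x"
      using a c h'0 by (simp add: A.r_distr)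
    also have "\<dots> = e x \<otimes>\<^bsub>A\<^esub> a \<otimes>\<^bsub>A\<^esub> e x \<oplus>\<^bsub>A\<^esub> e x \<otimes>\<^bsub>A\<^esub> a \<otimes>\<^bsub>A\<^esub> ?f"
      using a c by (simp add: A.a_comm)
    finally show "e x \<otimes>\<^bsub>A\<^esub> a = e x \<otimes>\<^bsub>A\<^esub> a \<otimes>\<^bsub>A\<^esub> e x \<oplus>\<^bsub>A\<^esub> e x \<otimes>\<^bsub>A\<^esub> a \<otimes>\<^bsub>A\<^esub> ?f" .
  qed
qed

section \<open>Evaluation at a minimal object\<close>

theorem corollary3p2:
  fixes K :: "('k, 'r) ring_scheme"
    and A :: "('k, 'a) module"
    and n :: nat and e :: "nat \<Rightarrow> 'a"
    and C :: "(nat, 'f) category"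
    and M :: "('a, 'm) module"
    and x :: nat
    and P :: "nat \<Rightarrow> ('a, 'p) module"
    and d :: "nat \<Rightarrow> 'p \<Rightarrow> 'p" and \<epsilon> :: "'p \<Rightarrow> 'm"
  assumes "fin_dim_algebra K A"
    and "directed_stratification A n e"
    and "associated_category K A n e C"
    and "left_module A M"
    and "finitely_generated A M"
    and "minimal_projective_resolution A P d \<epsilon> M"
    and "minimal_object C e M x"
  shows "minimal_projective_resolution (corner_ring A (e x))
           (\<lambda>i. eval_at (P i) (e x)) d \<epsilon> (eval_at M (e x))"
proof -
  interpret M: left_module A M by fact
  have obj: "Obj C = {1..n}" using assms(3) by (simp add: associated_category_def)
  have x: "x \<in> {1..n}" using assms(7) obj by (simp add: minimal_object_def)
  let ?S = "{y \<in> {1..n}. y \<noteq> x \<and> hom_set C y x \<noteq> {}}"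
  interpret predecessor_idempotent A "e x" "\<Oplus>\<^bsub>A\<^esub>y\<in>?S. e y"
    by (rule predecessor_idempotent_sum[OF assms(1-3) x])
  show ?thesis
  proof (rule minimal_projective_resolution_eval_at[OF assms(6)])
    fix m assume m: "m \<in> carrier M"
    have "e y \<odot>\<^bsub>M\<^esub> m = \<zero>\<^bsub>M\<^esub>" if y: "y \<in> ?S" for y
    proof -
      have "carrier (eval_at M (e y)) = {\<zero>\<^bsub>M\<^esub>}"
        using y assms(7) obj unfolding minimal_object_def by blast
      then show ?thesis using m by (auto simp: eval_at_def)
    qed
    moreover have "e \<in> ?S \<rightarrow> carrier A"
      using assms(2) by (auto simp: directed_stratification_def)
    ultimately show "(\<Oplus>\<^bsub>A\<^esub>y\<in>?S. e y) \<odot>\<^bsub>M\<^esub> m = \<zero>\<^bsub>M\<^esub>"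
      using m by (intro M.finsum_smult_zero) auto
  qed
qed

end
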